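(* Let $A$ be a $\mathbf{k}$-vector space with two binary (bilinear) operations $\vdash$ and $\dashv$. Equip the free $\mathbf{k}[\partial]$-module $Q:=\mathbf{k}[\partial]A=\mathbf{k}[\partial]\otimes A$ with the $\lambda$-bracket determined (by extending via conformal sesquilinearity) by $$[a_\lambda b]:=\partial(b\dashv a)+\lambda(a\vdash b+b\dashv a)\quad\text{for all } a,b\in A.$$ Then $(Q,[\cdot_\lambda\cdot])$ is a Leibniz conformal algebra if and only if $(A,\dashv,\vdash)$ is a Novikov dialgebra.
   Context: $\mathbf{k}$ is a field of characteristic zero; tensor products are over $\mathbf{k}$. A Leibniz conformal algebra is a $\mathbf{k}[\partial]$-module $Q$ with a $\mathbf{k}$-bilinear $\lambda$-bracket $[\cdot_\lambda\cdot]:Q\times Q\to Q[\lambda]$ such that for all $a,b,c\in Q$: $[\partial a_\lambda b]=-\lambda[a_\lambda b]$, $[a_\lambda\partial b]=(\lambda+\partial)[a_\lambda b]$ (conformal sesquilinearity), and $[a_\lambda[b_\mu c]]=[[a_\lambda b]_{\lambda+\mu}c]+[b_\mu[a_\lambda c]]$ (Jacobi identity). A (left) Novikov dialgebra $(A,\dashv,\vdash)$ is a vector space $A$ with two binary operations such that for all $a,b,c\in A$: $(a\vdash b)\dashv c=(a\vdash c)\vdash b=(a\dashv c)\vdash b$; $a\dashv(b\dashv c)=a\dashv(b\vdash c)$; $(a\dashv b)\dashv c=(a\dashv c)\dashv b$; $(a\dashv b)\dashv c-a\dashv(b\dashv c)=(b\vdash a)\dashv c-b\vdash(a\dashv c)$;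 $(a\vdash b)\vdash c-a\vdash(b\vdash c)=(b\vdash a)\vdash c-b\vdash(a\vdash c)$. *)

theory Defs
  imports "HOL-Computational_Algebra.Polynomial"
begin

text \<open>
  For an abelian group \<open>V\<close>, the type \<open>V poly\<close> serves as \<open>V[x]\<close>, with multiplication by \<open>x\<close>
  given by \<open>pCons 0\<close>. An operator acting on coefficients is lifted by \<^const>\<open>map_poly\<close>.
\<close>

text \<open>
  \<open>eval_at T h p\<close> substitutes the operator \<open>T\<close> for the variable of \<open>p\<close> and applies \<open>h\<close> to its
  coefficients: the sum of \<open>T^i (h p_i)\<close>. It is only used for additive \<open>h\<close>, so that the
  representation of \<open>p\<close> by finitely many coefficients is immaterial.
\<close>

definition eval_at :: "('v \<Rightarrow> 'v) \<Rightarrow> ('a \<Rightarrow> 'v) \<Rightarrow> 'a::zero poly \<Rightarrow> 'v::comm_monoid_add" where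
  "eval_at T h p = (\<Sum>i\<le>degree p. (T ^^ i) (h (coeff p i)))"


text \<open>
  The Jacobi identity lives in \<open>Q[\<lambda>,\<mu>]\<close>, represented as \<open>Q[\<lambda>][\<mu>]\<close>, i.e. \<open>'q poly poly\<close>
  with outer variable \<open>\<mu>\<close> and inner variable \<open>\<lambda>\<close>.
\<close>

definition mult_lambda :: "'q::ab_group_add poly poly \<Rightarrow> 'q poly poly" where
  "mult_lambda = map_poly (pCons 0)"

definition mult_mu :: "'q::ab_group_add poly poly \<Rightarrow> 'q poly poly" where
  "mult_mu = pCons 0"

definition mult_lambda_mu :: "'q::ab_group_add poly poly \<Rightarrow> 'q poly poly" where
  "mult_lambda_mu z = mult_lambda z + mult_mu z"

definition subst_var ::
    "('q poly poly \<Rightarrow> 'q poly poly) \<Rightarrow> 'q poly \<Rightarrow> 'q::ab_group_add poly poly" where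
  "subst_var T = eval_at T (\<lambda>q. [:[:q:]:])"

text \<open>
  \<open>smul\<close> is the action of \<open>k[\<partial>]\<close>, so that \<open>smul [:0, 1:]\<close> is \<open>\<partial>\<close> and the scalars from \<open>k\<close> act
  through \<open>smul [:c:]\<close>. The bracket takes values in \<open>Q[\<lambda>]\<close>. In the Jacobi identity the outer
  bracket is extended coefficientwise to polynomials: e.g. \<open>[a\<^sub>\<lambda>[b\<^sub>\<mu>c]]\<close> is the sum of
  \<open>\<mu>^j [a\<^sub>\<lambda> q\<^sub>j]\<close> if \<open>[b\<^sub>\<mu>c]\<close> is the sum of \<open>\<mu>^j q\<^sub>j\<close>.
\<close>

locale leibniz_conformal_algebra = module smul
  for smul :: "'k::field_char_0 poly \<Rightarrow> 'q::ab_group_add \<Rightarrow> 'q" +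
  fixes bracket :: "'q \<Rightarrow> 'q \<Rightarrow> 'q poly"
  assumes bracket_add_left: "bracket (a + b) c = bracket a c + bracket b c"
    and bracket_add_right: "bracket a (b + c) = bracket a b + bracket a c"
    and bracket_scale_left: "bracket (smul [:r:] a) b = map_poly (smul [:r:]) (bracket a b)"
    and bracket_scale_right: "bracket a (smul [:r:] b) = map_poly (smul [:r:]) (bracket a b)"
    and sesquilinear_left: "bracket (smul [:0, 1:] a) b = - pCons 0 (bracket a b)"
    and sesquilinear_right:
      "bracket a (smul [:0, 1:] b) = pCons 0 (bracket a b) + map_poly (smul [:0, 1:]) (bracket a b)"
    and jacobi:
      "eval_at mult_mu (\<lambda>x. subst_var mult_lambda (bracket a x)) (bracket b c)
       = eval_at mult_lambda (\<lambda>x. subst_var mult_lambda_mu (bracket x c)) (bracket a b)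
         + eval_at mult_lambda (\<lambda>x. subst_var mult_mu (bracket b x)) (bracket a c)"


definition bilinear_op ::
    "('k::field \<Rightarrow> 'a::ab_group_add \<Rightarrow> 'a) \<Rightarrow> ('a \<Rightarrow> 'a \<Rightarrow> 'a) \<Rightarrow> bool" where
  "bilinear_op scale f \<longleftrightarrow>
     (\<forall>x. Vector_Spaces.linear scale scale (\<lambda>y. f x y)) \<and>
     (\<forall>y. Vector_Spaces.linear scale scale (\<lambda>x. f x y))"

locale novikov_dialgebra = vector_space scale
  for scale :: "'k::field_char_0 \<Rightarrow> 'a::ab_group_add \<Rightarrow> 'a" +
  fixes dashv :: "'a \<Rightarrow> 'a \<Rightarrow> 'a"  (infixl "\<stileturn>" 70)
    and vdash :: "'a \<Rightarrow> 'a \<Rightarrow> 'a"  (infixl "\<turnstile>" 70)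
  assumes bilinear_dashv: "bilinear_op scale (\<stileturn>)"
    and bilinear_vdash: "bilinear_op scale (\<turnstile>)"
    and vdash_dashv: "(a \<turnstile> b) \<stileturn> c = (a \<turnstile> c) \<turnstile> b"
    and vdash_vdash: "(a \<turnstile> c) \<turnstile> b = (a \<stileturn> c) \<turnstile> b"
    and dashv_right: "a \<stileturn> (b \<stileturn> c) = a \<stileturn> (b \<turnstile> c)"
    and dashv_right_comm: "(a \<stileturn> b) \<stileturn> c = (a \<stileturn> c) \<stileturn> b"
    and assoc_dashv:
      "(a \<stileturn> b) \<stileturn> c - a \<stileturn> (b \<stileturn> c) = (b \<turnstile> a) \<stileturn> c - b \<turnstile> (a \<stileturn> c)"
    and assoc_vdash:
      "(a \<turnstile> b) \<turnstile> c - a \<turnstile> (b \<turnstile> c) = (b \<turnstile> a) \<turnstile> c - b \<turnstile> (a \<turnstile> c)"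


text \<open>
  The free module \<open>k[\<partial>] \<otimes> A\<close> is \<open>A[\<partial>]\<close>, i.e. \<open>'a poly\<close>: \<open>\<partial>^i \<otimes> a\<close> is \<open>monom a i\<close>, and \<open>\<partial>\<close> acts
  as \<open>pCons 0\<close>.
\<close>

definition free_smult ::
    "('k::field_char_0 \<Rightarrow> 'a::ab_group_add \<Rightarrow> 'a) \<Rightarrow> 'k poly \<Rightarrow> 'a poly \<Rightarrow> 'a poly" where
  "free_smult scale p v = eval_at (pCons 0) (\<lambda>c. map_poly (scale c) v) p"

text \<open>
  Elements of \<open>Q[\<lambda>] = A[\<partial>][\<lambda>]\<close> have outer variable \<open>\<lambda>\<close> and inner variable \<open>\<partial>\<close>.
  \<open>gen_bracket\<close> is \<open>\<partial>(b \<stileturn> a) + \<lambda>(a \<turnstile> b + b \<stileturn> a)\<close>.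
\<close>

definition gen_bracket ::
    "('a \<Rightarrow> 'a \<Rightarrow> 'a) \<Rightarrow> ('a \<Rightarrow> 'a \<Rightarrow> 'a) \<Rightarrow> 'a \<Rightarrow> 'a \<Rightarrow> 'a::ab_group_add poly poly" where
  "gen_bracket dashv vdash a b = [: [:0, dashv b a:], [:vdash a b + dashv b a:] :]"

text \<open>
  Sesquilinear extension: \<open>[f(\<partial>)a \<^sub>\<lambda> g(\<partial>)b] = f(-\<lambda>) g(\<lambda>+\<partial>) [a\<^sub>\<lambda>b]\<close>.
\<close>

definition free_bracket ::
    "('a \<Rightarrow> 'a \<Rightarrow> 'a) \<Rightarrow> ('a \<Rightarrow> 'a \<Rightarrow> 'a) \<Rightarrow> 'a poly \<Rightarrow> 'a poly \<Rightarrow> 'a::ab_group_add poly poly" where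
  "free_bracket dashv vdash f g =
     eval_at (\<lambda>z. - pCons 0 z)
       (\<lambda>a. eval_at (\<lambda>z. pCons 0 z + map_poly (pCons 0) z) (gen_bracket dashv vdash a) g) f"


subsection \<open>The extended bracket is the unique sesquilinear extension\<close>

lemma eval_at_pCons:
  assumes "T 0 = 0" "\<And>x y. T (x + y) = T x + T y" "h 0 = 0"
  shows "eval_at T h (pCons a p) = h a + T (eval_at T h p)"
proof -
  have s: "T (sum g B) = (\<Sum>i\<in>B. T (g i))" if "finite B" for g and B :: "nat set"
    using that by induction (auto simp: assms)
  show ?thesis
    by (cases "p = 0")
      (simp_all add: eval_at_def assms sum.atMost_Suc_shift s del: sum.atMost_Suc)
qed

lemma eval_at_add:
  assumes "T 0 = 0" "\<And>x y. T (x + y) = T x + T y" "h 0 = 0" "\<And>x y. h (x + y) = h x + h y"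
  shows "eval_at T h (p + q) = eval_at T h p + eval_at T h q"
proof (induction p q rule: poly_induct2)
  case 0
  then show ?case by (simp add: eval_at_def assms)
next
  case (pCons a p b q)
  then show ?case by (simp add: eval_at_pCons[of T h, OF assms(1,2,3)] assms algebra_simps)
qed

context
  fixes scale :: "'k::field_char_0 \<Rightarrow> 'a::ab_group_add \<Rightarrow> 'a"
    and dashv vdash :: "'a \<Rightarrow> 'a \<Rightarrow> 'a"
  assumes vs: "vector_space scale"
    and bl: "bilinear_op scale dashv" "bilinear_op scale vdash"
begin

interpretation vector_space scale by (fact vs)

lemma free_smult_pCons:
  "free_smult scale (pCons c p) v = map_poly (scale c) v + pCons 0 (free_smult scale p v)"
proof -
  have "map_poly (scale 0) v = 0" by (rule poly_eqI) (simp add: coeff_map_poly)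
  then show ?thesis unfolding free_smult_def by (subst eval_at_pCons) auto
qed

lemma free_smult_0: "free_smult scale 0 v = 0"
  by (auto simp: free_smult_def eval_at_def coeff_map_poly intro!: poly_eqI)

lemma free_smult_const: "free_smult scale [:c:] v = map_poly (scale c) v"
  by (simp add: free_smult_pCons free_smult_0)

lemma free_smult_del: "free_smult scale [:0, 1:] v = pCons 0 v"
  by (auto simp: free_smult_pCons free_smult_0 coeff_map_poly coeff_pCons split: nat.split intro!: poly_eqI)

lemma ops_add:
  "dashv (a + b) c = dashv a c + dashv b c" "dashv c (a + b) = dashv c a + dashv c b"
  "vdash (a + b) c = vdash a c + vdash b c" "vdash c (a + b) = vdash c a + vdash c b"
  using bl by (simp_all add: bilinear_op_def Vector_Spaces.linear_iff)

lemma ops_0: "dashv 0 c = 0" "dashv c 0 = 0" "vdash 0 c = 0" "vdash c 0 = 0"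
  using ops_add[of 0 0 c] ops_add(2,4)[of c 0 0] by simp_all

lemma gen_bracket_add:
  "gen_bracket dashv vdash (a + b) c = gen_bracket dashv vdash a c + gen_bracket dashv vdash b c"
  "gen_bracket dashv vdash c (a + b) = gen_bracket dashv vdash c a + gen_bracket dashv vdash c b"
  by (simp_all add: gen_bracket_def ops_add algebra_simps)

lemma gen_bracket_0: "gen_bracket dashv vdash 0 c = 0" "gen_bracket dashv vdash c 0 = 0"
  by (simp_all add: gen_bracket_def ops_0)

lemma map_pCons_add:
  "map_poly (pCons (0::'a)) (x + y) = map_poly (pCons 0) x + map_poly (pCons 0) y"
  by (rule poly_eqI) (simp add: coeff_map_poly)

private definition half where
  "half g a = eval_at (\<lambda>z. pCons 0 z + map_poly (pCons 0) z) (gen_bracket dashv vdash a) g"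

lemma half_pCons:
  "half (pCons b g) a = gen_bracket dashv vdash a b + (pCons 0 (half g a) + map_poly (pCons 0) (half g a))"
  unfolding half_def by (subst eval_at_pCons) (simp_all add: gen_bracket_0 map_pCons_add algebra_simps)

lemma half_0: "half 0 a = 0"
  by (simp add: half_def eval_at_def gen_bracket_0)

lemma half_add: "half g (a + b) = half g a + half g b"
  by (induction g) (simp_all add: half_0 half_pCons gen_bracket_add map_pCons_add algebra_simps)

lemma half_add_right: "half (f + g) a = half f a + half g a"
  unfolding half_def by (rule eval_at_add) (simp_all add: gen_bracket_0 gen_bracket_add map_pCons_add algebra_simps)

lemma half_zero: "half g 0 = 0"
  using half_add[of g 0 0] by simp

lemma free_bracket_pCons:
  "free_bracket dashv vdash (pCons a f) g = half g a - pCons 0 (free_bracket dashv vdash f g)"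
  unfolding free_bracket_def half_def[symmetric] by (subst eval_at_pCons) (simp_all add: half_zero)

lemma free_bracket_0: "free_bracket dashv vdash 0 g = 0"
  unfolding free_bracket_def half_def[symmetric] by (simp add: eval_at_def half_zero)

lemma free_bracket_generators:
  "free_bracket dashv vdash [:a:] [:b:] = gen_bracket dashv vdash a b"
  by (simp add: free_bracket_pCons free_bracket_0 half_pCons half_0)

lemma free_bracket_add_left:
  "free_bracket dashv vdash (f + f') g = free_bracket dashv vdash f g + free_bracket dashv vdash f' g"
  unfolding free_bracket_def half_def[symmetric] by (rule eval_at_add) (simp_all add: half_zero half_add)

lemma free_bracket_add_right:
  "free_bracket dashv vdash f (g + g') = free_bracket dashv vdash f g + free_bracket dashv vdash f g'"
  by (induction f) (simp_all add: free_bracket_0 free_bracket_pCons half_add_right algebra_simps)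

lemma free_bracket_sesquilinear_left:
  "free_bracket dashv vdash (free_smult scale [:0, 1:] f) g = - pCons 0 (free_bracket dashv vdash f g)"
  by (simp add: free_smult_del free_bracket_pCons half_zero)

lemma free_bracket_sesquilinear_right:
  "free_bracket dashv vdash f (free_smult scale [:0, 1:] g) =
   pCons 0 (free_bracket dashv vdash f g) +
   map_poly (free_smult scale [:0, 1:]) (free_bracket dashv vdash f g)"
proof -
  have e: "free_smult scale [:0, 1:] = pCons 0" by (rule ext) (rule free_smult_del)
  have m: "map_poly (pCons 0) (x - y) = map_poly (pCons 0) x - map_poly (pCons 0) y"
    for x y :: "'a poly poly" by (rule poly_eqI) (simp add: coeff_map_poly)
  have p: "map_poly (pCons 0) (pCons 0 x) = pCons 0 (map_poly (pCons 0) x)"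
    for x :: "'a poly poly"
    by (rule poly_eqI) (simp add: coeff_map_poly coeff_pCons split: nat.split)
  show ?thesis unfolding e
    by (induction f)
      (simp_all add: free_bracket_0 free_bracket_pCons half_pCons gen_bracket_0 m p algebra_simps)
qed

lemma free_bracket_unique:
  assumes "\<And>f f' g. B (f + f') g = B f g + B f' g" "\<And>f g g'. B f (g + g') = B f g + B f g'"
    and "\<And>f g. B (free_smult scale [:0, 1:] f) g = - pCons 0 (B f g)"
    and "\<And>f g. B f (free_smult scale [:0, 1:] g) =
                pCons 0 (B f g) + map_poly (free_smult scale [:0, 1:]) (B f g)"
    and "\<And>a b. B [:a:] [:b:] = gen_bracket dashv vdash a b"
  shows "B = free_bracket dashv vdash"
proof (intro ext)
  have e: "free_smult scale [:0, 1:] = pCons 0" by (rule ext) (rule free_smult_del)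
  note B = assms[unfolded e]
  have z: "B f 0 = 0" "B 0 f = 0" for f using B(1)[of 0 0] B(2)[of _ 0 0] by simp_all
  have s: "pCons a p = [:a:] + pCons 0 p" for a :: 'a and p by simp
  have g: "B [:a:] g = half g a" for a g
  proof (induction g)
    case 0 show ?case by (simp add: z half_0)
  next
    case (pCons b g)
    then show ?case by (subst s) (simp only: B half_pCons)
  qed
  show "B f g = free_bracket dashv vdash f g" for f g
  proof (induction f)
    case 0 show ?case by (simp add: z free_bracket_0)
  next
    case (pCons a f)
    then show ?case by (subst s) (simp only: B g free_bracket_pCons, simp)
  qed
qed

end

end

theory Submission imports Defs
begin

text \<open>
  By sesquilinearity, replacing \<open>a\<close>, \<open>b\<close> or \<open>c\<close> by its image under \<open>\<partial>\<close> acts on each of the three terms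
  of the Jacobi identity in the same way: the term is multiplied by \<open>-\<lambda>\<close>, \<open>-\<mu>\<close> or \<open>\<lambda> + \<mu> + \<partial>\<close>
  respectively. As all terms are additive in \<open>a\<close>, \<open>b\<close>, \<open>c\<close>, the identity holds on the whole of
  \<open>k[\<partial>]A\<close> as soon as it holds for \<open>a, b, c\<close> in \<open>A\<close> (\<open>jacobi_from_generators\<close>). The other axioms
  of a Leibniz conformal algebra hold for every bracket obtained by sesquilinear extension from
  bilinear operations, so the Jacobi identity on \<open>A\<close> is the only condition (\<open>leibniz_iff_jacobi\<close>).

  For \<open>a, b, c\<close> in \<open>A\<close> both sides of the identity are quadratic forms in \<open>\<partial>, \<lambda>, \<mu>\<close> with coefficients
  in \<open>A\<close> (\<open>jacobi_lhs_generators\<close>, \<open>jacobi_rhs_generators\<close>). Comparing the six coefficients gives a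
  system of identities for \<open>\<stileturn>\<close> and \<open>\<turnstile>\<close> that is equivalent to the axioms of a Novikov dialgebra by
  elimination (\<open>jacobi_coefficients_iff_novikov\<close>).
\<close>

section \<open>Substituting an additive operator into a polynomial\<close>

lemma additive_map_poly:
  assumes "additive f"
  shows "additive (map_poly f)"
  using assms by (auto simp: additive_def coeff_map_poly additive.zero[OF assms] intro!: poly_eqI)

lemma additive_pCons_0: "additive (pCons (0::'a::ab_group_add))"
  by (simp add: additive_def)

lemma map_poly_pCons_additive:
  assumes "additive f"
  shows "map_poly f (pCons a p) = pCons (f a) (map_poly f p)"
  by (simp add: map_poly_pCons additive.zero[OF assms])

text \<open>
  A polynomial is a constant plus a multiple of the variable, so additive maps on \<open>A[\<partial>]\<close> that react
  in the same way to multiplication by \<open>\<partial>\<close> are determined by their values on \<open>A\<close>. This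
  is the induction by which identities for sesquilinear brackets are reduced to generators.
\<close>

lemma additive_poly_eqI:
  fixes F G :: "'a::ab_group_add poly \<Rightarrow> 'b::ab_group_add"
  assumes "additive F" "additive G"
    and "\<And>a. F [:a:] = G [:a:]"
    and "\<And>p. F p = G p \<Longrightarrow> F (pCons 0 p) = G (pCons 0 p)"
  shows "F p = G p"
proof (induction p)
  case 0
  show ?case using assms(1,2) by (simp add: additive.zero)
next
  case (pCons a p)
  have "pCons a p = [:a:] + pCons 0 p" by simp
  then show ?case
    using assms(3,4) pCons.IH additive.add[OF assms(1)] additive.add[OF assms(2)] by metis
qed

context
  fixes T :: "'v::ab_group_add \<Rightarrow> 'v" and h :: "'a::ab_group_add \<Rightarrow> 'v"
  assumes T: "additive T" and h: "additive h"
begin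

lemma eval_at_pCons_additive: "eval_at T h (pCons a p) = h a + T (eval_at T h p)"
  by (rule eval_at_pCons) (simp_all add: additive.zero[OF T] additive.add[OF T] additive.zero[OF h])

lemma eval_at_0: "eval_at T h 0 = 0"
  by (simp add: eval_at_def additive.zero[OF h])

lemma additive_eval_at: "additive (eval_at T h)"
  unfolding additive_def
  by (intro allI eval_at_add)
    (simp_all add: additive.zero[OF T] additive.add[OF T] additive.zero[OF h] additive.add[OF h])

lemma eval_at_shift: "eval_at T h (pCons 0 p) = T (eval_at T h p)"
  by (simp add: eval_at_pCons_additive additive.zero[OF h])

end

lemma eval_at_map_poly:
  assumes "additive T" "additive h" "additive d"
  shows "eval_at T h (map_poly d p) = eval_at T (\<lambda>x. h (d x)) p"
proof -
  have "additive (\<lambda>x. h (d x))"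
    using assms(2,3) by (simp add: additive_def)
  then show ?thesis
    using assms
    by (induction p) (simp_all add: eval_at_0 eval_at_pCons_additive map_poly_pCons_additive)
qed

lemma eval_at_comp_additive:
  assumes "additive T" "additive h" "additive S" "\<And>z. S (T z) = T (S z)"
  shows "eval_at T (\<lambda>x. S (h x)) p = S (eval_at T h p)"
proof -
  have "additive (\<lambda>x. S (h x))"
    using assms(2,3) by (simp add: additive_def)
  then show ?thesis
    using assms
    by (induction p) (simp_all add: eval_at_0 eval_at_pCons_additive additive.zero additive.add)
qed

lemma eval_at_add_fun: "eval_at T (\<lambda>x. h x + k x) p = eval_at T h p + eval_at T k p"
  if "additive T" for T :: "'v::ab_group_add \<Rightarrow> 'v"
proof -
  have "additive (T ^^ i)" for i
    using that by (induction i) (simp_all add: additive_def)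
  then show ?thesis
    by (simp add: eval_at_def sum.distrib additive.add)
qed

lemma additive_const_const: "additive (\<lambda>q::'q::ab_group_add. [:[:q:]:])"
  by (simp add: additive_def)

lemma additive_subst_var: "additive T \<Longrightarrow> additive (subst_var T)"
  unfolding subst_var_def by (intro additive_eval_at additive_const_const)

lemma subst_var_0: "additive T \<Longrightarrow> subst_var T 0 = 0"
  by (rule additive.zero[OF additive_subst_var])

lemma subst_var_pCons: "additive T \<Longrightarrow> subst_var T (pCons q p) = [:[:q:]:] + T (subst_var T p)"
  unfolding subst_var_def by (intro eval_at_pCons_additive additive_const_const)

lemma subst_var_map_poly:
  assumes "additive T" "additive d" "\<And>z. map_poly (map_poly d) (T z) = T (map_poly (map_poly d) z)"
  shows "subst_var T (map_poly d p) = map_poly (map_poly d) (subst_var T p)"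
proof -
  have D: "additive (map_poly (map_poly d))"
    using assms by (intro additive_map_poly)
  have const: "map_poly (map_poly d) [:[:q:]:] = [:[:d q:]:]" for q
    using assms(2) by (simp add: map_poly_pCons_additive additive_map_poly)
  show ?thesis
    unfolding subst_var_def
    by (simp add: eval_at_map_poly assms additive_const_const D const
        flip: eval_at_comp_additive)
qed

section \<open>The variables as commuting operators\<close>

lemma additive_mult_mu: "additive mult_mu"
  unfolding mult_mu_def by (rule additive_pCons_0)

lemma additive_mult_lambda: "additive mult_lambda"
  unfolding mult_lambda_def by (intro additive_map_poly additive_pCons_0)

lemma additive_mult_lambda_mu: "additive mult_lambda_mu"
  by (rule additive.intro) (simp add: mult_lambda_mu_def algebra_simps
      additive.add[OF additive_mult_mu] additive.add[OF additive_mult_lambda])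

lemma mult_lambda_mult_mu: "mult_lambda (mult_mu z) = mult_mu (mult_lambda z)"
  by (simp add: mult_lambda_def mult_mu_def map_poly_pCons_additive additive_pCons_0)

lemma map_poly_pCons_0_commute:
  assumes "additive d"
  shows "map_poly d (pCons 0 p) = pCons 0 (map_poly d p)"
  by (simp add: map_poly_pCons_additive assms additive.zero)

text \<open>
  Operators on \<open>Q\<close> such as \<open>\<partial>\<close> or a scalar act on \<open>Q[\<lambda>, \<mu>]\<close> through the coefficients. That they
  commute with the variables is what allows moving them out of a nested bracket.
\<close>

lemma coefficientwise_commutes:
  assumes "additive d"
  shows "map_poly (map_poly d) (mult_mu z) = mult_mu (map_poly (map_poly d) z)"
    and "map_poly (map_poly d) (mult_lambda z) = mult_lambda (map_poly (map_poly d) z)"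
    and "map_poly (map_poly d) (mult_lambda_mu z) = mult_lambda_mu (map_poly (map_poly d) z)"
proof -
  have D: "additive (map_poly (map_poly d))"
    using assms by (intro additive_map_poly)
  show mu: "map_poly (map_poly d) (mult_mu z) = mult_mu (map_poly (map_poly d) z)"
    unfolding mult_mu_def by (intro map_poly_pCons_0_commute additive_map_poly assms)
  show lam: "map_poly (map_poly d) (mult_lambda z) = mult_lambda (map_poly (map_poly d) z)"
    by (rule poly_eqI)
      (simp add: mult_lambda_def coeff_map_poly map_poly_pCons_0_commute assms)
  show "map_poly (map_poly d) (mult_lambda_mu z) = mult_lambda_mu (map_poly (map_poly d) z)"
    by (simp add: mult_lambda_mu_def mu lam additive.add[OF D])
qed

section \<open>The Jacobi identity is compatible with the derivation\<close>

locale sesquilinear_bracket =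
  fixes del :: "'q::ab_group_add \<Rightarrow> 'q" and bracket :: "'q \<Rightarrow> 'q \<Rightarrow> 'q poly"
  assumes additive_del: "additive del"
    and additive_left: "additive (\<lambda>a. bracket a b)"
    and additive_right: "additive (bracket a)"
    and del_left: "bracket (del a) b = - pCons 0 (bracket a b)"
    and del_right: "bracket a (del b) = pCons 0 (bracket a b) + map_poly del (bracket a b)"
begin

abbreviation del_coeffs :: "'q poly poly \<Rightarrow> 'q poly poly" where
  "del_coeffs \<equiv> map_poly (map_poly del)"

text \<open>
  These are the brackets \<open>[a\<^bsub>S\<^esub>[b\<^bsub>T\<^esub>c]]\<close> and \<open>[[a\<^bsub>T\<^esub>b]\<^bsub>S\<^esub>c]\<close>, with the variables
  kept as operators \<open>S\<close> and \<open>T\<close> on \<open>Q[\<lambda>, \<mu>]\<close>: the terms of the Jacobi identity substitute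
  \<open>\<lambda>\<close>, \<open>\<mu>\<close> and \<open>\<lambda> + \<mu>\<close> in different places, and all of them can be treated at once.
\<close>

definition nest_right ::
    "('q poly poly \<Rightarrow> 'q poly poly) \<Rightarrow> ('q poly poly \<Rightarrow> 'q poly poly) \<Rightarrow> 'q \<Rightarrow> 'q \<Rightarrow> 'q \<Rightarrow> 'q poly poly" where
  "nest_right S T a b c = eval_at T (\<lambda>x. subst_var S (bracket a x)) (bracket b c)"

definition nest_left ::
    "('q poly poly \<Rightarrow> 'q poly poly) \<Rightarrow> ('q poly poly \<Rightarrow> 'q poly poly) \<Rightarrow> 'q \<Rightarrow> 'q \<Rightarrow> 'q \<Rightarrow> 'q poly poly" where
  "nest_left S T a b c = eval_at T (\<lambda>x. subst_var S (bracket x c)) (bracket a b)"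

lemma additive_del_coeffs: "additive del_coeffs"
  by (intro additive_map_poly additive_del)

lemma additive_inner:
  assumes "additive S"
  shows "additive (\<lambda>x. subst_var S (bracket a x))" "additive (\<lambda>x. subst_var S (bracket x c))"
  using additive_subst_var[OF assms] additive_left additive_right by (simp_all add: additive_def)

context
  fixes S T :: "'q poly poly \<Rightarrow> 'q poly poly"
  assumes S: "additive S" and T: "additive T" and ST: "\<And>z. S (T z) = T (S z)"
    and DS: "\<And>z. del_coeffs (S z) = S (del_coeffs z)"
    and DT: "\<And>z. del_coeffs (T z) = T (del_coeffs z)"
begin

lemma inner_del:
  "subst_var S (bracket (del a) b) = - S (subst_var S (bracket a b))"
  "subst_var S (bracket a (del b)) =
     S (subst_var S (bracket a b)) + del_coeffs (subst_var S (bracket a b))"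
  by (simp_all add: del_left del_right additive.minus[OF S] additive.minus[OF additive_subst_var[OF S]]
      additive.add[OF additive_subst_var[OF S]] subst_var_pCons[OF S]
      subst_var_map_poly[OF S additive_del DS])

lemma outer_comp:
  assumes "additive R" "\<And>z. R (T z) = T (R z)"
  shows "eval_at T (\<lambda>x. R (subst_var S (bracket a x))) p = R (eval_at T (\<lambda>x. subst_var S (bracket a x)) p)"
    and "eval_at T (\<lambda>x. R (subst_var S (bracket x c))) p = R (eval_at T (\<lambda>x. subst_var S (bracket x c)) p)"
  by (rule eval_at_comp_additive[OF T _ assms], rule additive_inner[OF S])+

lemma additive_neg_S: "additive (\<lambda>z. - S z)"
  using S by (simp add: additive_def)

lemma additive_nest_right:
  "additive (\<lambda>a. nest_right S T a b c)"
  "additive (\<lambda>b. nest_right S T a b c)"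
  "additive (\<lambda>c. nest_right S T a b c)"
proof -
  note e = additive.add[OF additive_eval_at[OF T additive_inner(1)[OF S]]]
  show "additive (\<lambda>a. nest_right S T a b c)"
    by (simp add: additive_def nest_right_def additive.add[OF additive_left]
        additive.add[OF additive_subst_var[OF S]] eval_at_add_fun[OF T])
  show "additive (\<lambda>b. nest_right S T a b c)" "additive (\<lambda>c. nest_right S T a b c)"
    by (simp_all add: additive_def nest_right_def additive.add[OF additive_left]
        additive.add[OF additive_right] e)
qed

lemma additive_nest_left:
  "additive (\<lambda>a. nest_left S T a b c)"
  "additive (\<lambda>b. nest_left S T a b c)"
  "additive (\<lambda>c. nest_left S T a b c)"
proof -
  note e = additive.add[OF additive_eval_at[OF T additive_inner(2)[OF S]]]
  show "additive (\<lambda>a. nest_left S T a b c)" "additive (\<lambda>b. nest_left S T a b c)"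
    by (simp_all add: additive_def nest_left_def additive.add[OF additive_left]
        additive.add[OF additive_right] e)
  show "additive (\<lambda>c. nest_left S T a b c)"
    by (simp add: additive_def nest_left_def additive.add[OF additive_right]
        additive.add[OF additive_subst_var[OF S]] eval_at_add_fun[OF T])
qed

text \<open>
  Moving \<open>\<partial>\<close> out of \<open>c\<close> produces \<open>T + \<partial>\<close> at the inner bracket, and its \<open>\<partial>\<close> then passes through the
  outer bracket as \<open>S + \<partial>\<close>.
\<close>

lemma nest_right_del:
  "nest_right S T (del a) b c = - S (nest_right S T a b c)"
  "nest_right S T a (del b) c = - T (nest_right S T a b c)"
  "nest_right S T a b (del c) =
     S (nest_right S T a b c) + T (nest_right S T a b c) + del_coeffs (nest_right S T a b c)"
proof -
  note e = additive_eval_at[OF T additive_inner(1)[OF S]]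
  show "nest_right S T (del a) b c = - S (nest_right S T a b c)"
    unfolding nest_right_def inner_del
    by (rule outer_comp(1)[OF additive_neg_S]) (simp add: ST additive.minus[OF T])
  show "nest_right S T a (del b) c = - T (nest_right S T a b c)"
    by (simp add: nest_right_def del_left additive.minus[OF e] additive.minus[OF T]
        eval_at_shift[OF T additive_inner(1)[OF S]])
  show "nest_right S T a b (del c) =
     S (nest_right S T a b c) + T (nest_right S T a b c) + del_coeffs (nest_right S T a b c)"
    by (simp add: nest_right_def del_right[of b] additive.add[OF e]
        eval_at_shift[OF T additive_inner(1)[OF S]]
        eval_at_map_poly[OF T additive_inner(1)[OF S] additive_del] inner_del eval_at_add_fun[OF T]
        outer_comp(1)[OF S ST] outer_comp(1)[OF additive_del_coeffs DT])
qed

text \<open>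
  In the middle argument, the factor \<open>T + \<partial>\<close> from the inner bracket turns into \<open>T - S\<close>, because
  this \<open>\<partial>\<close> stands in the left argument of the outer bracket. For \<open>S = \<lambda> + \<mu>\<close> and \<open>T = \<lambda>\<close> this is \<open>-\<mu>\<close>, in
  agreement with the other terms of the Jacobi identity.
\<close>

lemma nest_left_del:
  "nest_left S T (del a) b c = - T (nest_left S T a b c)"
  "nest_left S T a (del b) c = T (nest_left S T a b c) - S (nest_left S T a b c)"
  "nest_left S T a b (del c) = S (nest_left S T a b c) + del_coeffs (nest_left S T a b c)"
proof -
  note e = additive_eval_at[OF T additive_inner(2)[OF S]]
  have neg: "eval_at T (\<lambda>x. - S (subst_var S (bracket x c))) p
      = - S (eval_at T (\<lambda>x. subst_var S (bracket x c)) p)" for p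
    by (rule outer_comp(2)[OF additive_neg_S]) (simp add: ST additive.minus[OF T])
  show "nest_left S T (del a) b c = - T (nest_left S T a b c)"
    by (simp add: nest_left_def del_left additive.minus[OF e] additive.minus[OF T]
        eval_at_shift[OF T additive_inner(2)[OF S]])
  show "nest_left S T a (del b) c = T (nest_left S T a b c) - S (nest_left S T a b c)"
    by (simp add: nest_left_def del_right[of a] additive.add[OF e]
        eval_at_shift[OF T additive_inner(2)[OF S]]
        eval_at_map_poly[OF T additive_inner(2)[OF S] additive_del] inner_del neg)
  show "nest_left S T a b (del c) = S (nest_left S T a b c) + del_coeffs (nest_left S T a b c)"
    by (simp add: nest_left_def inner_del eval_at_add_fun[OF T]
        outer_comp(2)[OF S ST] outer_comp(2)[OF additive_del_coeffs DT])
qed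

end

definition jacobi_lhs :: "'q \<Rightarrow> 'q \<Rightarrow> 'q \<Rightarrow> 'q poly poly" where
  "jacobi_lhs = nest_right mult_lambda mult_mu"

definition jacobi_rhs :: "'q \<Rightarrow> 'q \<Rightarrow> 'q \<Rightarrow> 'q poly poly" where
  "jacobi_rhs a b c =
     nest_left mult_lambda_mu mult_lambda a b c + nest_right mult_mu mult_lambda b a c"

text \<open>
  The next facts provide the hypotheses on \<open>S\<close> and \<open>T\<close> above for the three pairs of operators that
  occur in the Jacobi identity.
\<close>

lemma mult_lambda_mu_commute: "mult_lambda_mu (mult_lambda z) = mult_lambda (mult_lambda_mu z)"
  by (simp add: mult_lambda_mu_def additive.add[OF additive_mult_lambda] mult_lambda_mult_mu)

lemmas lambda_mu_commuting = additive_mult_lambda additive_mult_mu mult_lambda_mult_mu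
  coefficientwise_commutes(2,1)[OF additive_del]

lemmas lambda_plus_mu_lambda_commuting = additive_mult_lambda_mu additive_mult_lambda mult_lambda_mu_commute
  coefficientwise_commutes(3,2)[OF additive_del]

lemmas mu_lambda_commuting = additive_mult_mu additive_mult_lambda mult_lambda_mult_mu[symmetric]
  coefficientwise_commutes(1,2)[OF additive_del]

lemma additive_jacobi_lhs:
  "additive (\<lambda>a. jacobi_lhs a b c)" "additive (\<lambda>b. jacobi_lhs a b c)" "additive (\<lambda>c. jacobi_lhs a b c)"
  unfolding jacobi_lhs_def
  using additive_nest_right[where S = mult_lambda and T = mult_mu, OF lambda_mu_commuting]
  by blast+

lemma additive_jacobi_rhs:
  "additive (\<lambda>a. jacobi_rhs a b c)" "additive (\<lambda>b. jacobi_rhs a b c)" "additive (\<lambda>c. jacobi_rhs a b c)"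
  using additive_nest_right[where S = mult_mu and T = mult_lambda, OF mu_lambda_commuting]
    additive_nest_left[where S = mult_lambda_mu and T = mult_lambda,
        OF lambda_plus_mu_lambda_commuting]
  by (simp_all add: jacobi_rhs_def additive_def)

lemma jacobi_lhs_del:
  "jacobi_lhs (del a) b c = - mult_lambda (jacobi_lhs a b c)"
  "jacobi_lhs a (del b) c = - mult_mu (jacobi_lhs a b c)"
  "jacobi_lhs a b (del c) = mult_lambda_mu (jacobi_lhs a b c) + del_coeffs (jacobi_lhs a b c)"
  unfolding jacobi_lhs_def mult_lambda_mu_def
  by (rule nest_right_del[where S = mult_lambda and T = mult_mu, OF lambda_mu_commuting])+

lemma jacobi_rhs_del:
  "jacobi_rhs (del a) b c = - mult_lambda (jacobi_rhs a b c)"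
  "jacobi_rhs a (del b) c = - mult_mu (jacobi_rhs a b c)"
  "jacobi_rhs a b (del c) = mult_lambda_mu (jacobi_rhs a b c) + del_coeffs (jacobi_rhs a b c)"
  unfolding jacobi_rhs_def
  by (simp_all add: nest_right_del[where S = mult_mu and T = mult_lambda, OF mu_lambda_commuting]
      nest_left_del[where S = mult_lambda_mu and T = mult_lambda,
        OF lambda_plus_mu_lambda_commuting]
      mult_lambda_mu_def additive.add[OF additive_mult_lambda] additive.add[OF additive_mult_mu]
      additive.add[OF additive_map_poly[OF additive_map_poly[OF additive_del]]] algebra_simps)

end

lemma jacobi_from_generators:
  fixes bracket :: "'a::ab_group_add poly \<Rightarrow> 'a poly \<Rightarrow> 'a poly poly"
  assumes "sesquilinear_bracket (pCons 0) bracket"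
  defines "L \<equiv> sesquilinear_bracket.jacobi_lhs bracket"
    and "R \<equiv> sesquilinear_bracket.jacobi_rhs bracket"
  assumes gen: "\<And>a b c. L [:a:] [:b:] [:c:] = R [:a:] [:b:] [:c:]"
  shows "L f g h = R f g h"
proof -
  interpret sesquilinear_bracket "pCons 0" bracket by fact
  note add = additive_jacobi_lhs additive_jacobi_rhs and del = jacobi_lhs_del jacobi_rhs_del
  have "L [:a:] [:b:] h = R [:a:] [:b:] h" for a b h
    unfolding L_def R_def using gen[unfolded L_def R_def]
    by (rule additive_poly_eqI[OF add(3,6)]) (simp add: del)
  then have "L [:a:] g h = R [:a:] g h" for a g h
    unfolding L_def R_def by (rule additive_poly_eqI[OF add(2,5)]) (simp add: del)
  then show ?thesis
    unfolding L_def R_def by (rule additive_poly_eqI[OF add(1,4)]) (simp add: del)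
qed

section \<open>The free module and its bracket\<close>

context
  fixes scale :: "'k::field_char_0 \<Rightarrow> 'a::ab_group_add \<Rightarrow> 'a"
    and dashv :: "'a \<Rightarrow> 'a \<Rightarrow> 'a" (infixl "\<stileturn>" 70)
    and vdash :: "'a \<Rightarrow> 'a \<Rightarrow> 'a" (infixl "\<turnstile>" 70)
  assumes vs: "vector_space scale"
    and bl: "bilinear_op scale dashv" "bilinear_op scale vdash"
begin

interpretation vector_space scale by (fact vs)

private abbreviation (input) "B \<equiv> free_bracket dashv vdash"

private lemmas
  smult_pCons = free_smult_pCons[OF vs bl] and
  smult_0 = free_smult_0[OF vs bl] and
  smult_const = free_smult_const[OF vs bl] and
  smult_del = free_smult_del[OF vs bl] and
  add_ops = ops_add[OF vs bl]

lemma additive_scale: "additive (scale r)"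
  by (simp add: additive_def scale_right_distrib)

lemma map_poly_scale:
  "map_poly (scale (r + s)) v = map_poly (scale r) v + map_poly (scale s) v"
  "map_poly (scale r) (map_poly (scale s) v) = map_poly (scale (r * s)) v"
  "map_poly (scale 0) v = 0"
  "map_poly (scale 1) v = v"
  by (rule poly_eqI, simp add: coeff_map_poly scale_left_distrib)+

lemma module_free_smult: "module (free_smult scale)"
proof
  fix p q and u v :: "'a poly"
  note add = additive.add[OF additive_map_poly[OF additive_scale]]
  show "free_smult scale p (u + v) = free_smult scale p u + free_smult scale p v"
    by (induction p) (simp_all add: smult_0 smult_pCons add algebra_simps)
  show distrib: "free_smult scale (p + q) v = free_smult scale p v + free_smult scale q v" for p q v
    by (induction p q rule: poly_induct2) (simp_all add: smult_0 smult_pCons map_poly_scale algebra_simps)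
  have smult: "free_smult scale (smult c q) v = map_poly (scale c) (free_smult scale q v)" for c
    by (induction q)
      (simp_all add: smult_0 smult_pCons map_poly_scale add map_poly_pCons_0_commute additive_scale)
  show "free_smult scale p (free_smult scale q v) = free_smult scale (p * q) v"
    by (induction p) (simp_all add: smult_0 smult_pCons distrib smult map_poly_scale)
  show "free_smult scale 1 v = v"
    by (simp add: one_pCons smult_const map_poly_scale)
qed

lemma sesquilinear_free_bracket: "sesquilinear_bracket (pCons 0) B"
proof
  fix f g
  show "B (pCons 0 f) g = - pCons 0 (B f g)"
    using free_bracket_sesquilinear_left[OF vs bl] by (simp add: smult_del)
  have "free_smult scale [:0, 1:] = pCons 0" by (rule ext) (rule smult_del)
  then show "B f (pCons 0 g) = pCons 0 (B f g) + map_poly (pCons 0) (B f g)"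
    using free_bracket_sesquilinear_right[OF vs bl, of f g] by simp
qed (simp_all add: free_bracket_add_left[OF vs bl] free_bracket_add_right[OF vs bl])

interpretation free: sesquilinear_bracket "pCons 0" B
  by (rule sesquilinear_free_bracket)

text \<open>
  The bracket of generators is bilinear over \<open>k\<close>, and scalars commute with \<open>\<partial>\<close> and \<open>\<lambda>\<close>, so
  bilinearity extends from generators by induction in each argument.
\<close>

lemma free_bracket_scale:
  "B (map_poly (scale r) f) g = map_poly (map_poly (scale r)) (B f g)"
  "B f (map_poly (scale r) g) = map_poly (map_poly (scale r)) (B f g)"
proof -
  let ?s = "map_poly (scale r)" and ?ss = "map_poly (map_poly (scale r))"
  note s = additive_map_poly[OF additive_scale] and ss = additive_map_poly[OF additive_map_poly[OF additive_scale]]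
  note simps = free.del_left free.del_right additive.add[OF s] additive.add[OF ss] additive.minus[OF ss]
    coefficientwise_commutes(1,2)[OF additive_scale, unfolded mult_mu_def mult_lambda_def]
    map_poly_pCons_0_commute[OF additive_scale] free_bracket_generators[OF vs bl]
  have ops: "dashv (scale r a) b = scale r (dashv a b)" "dashv a (scale r b) = scale r (dashv a b)"
    "vdash (scale r a) b = scale r (vdash a b)" "vdash a (scale r b) = scale r (vdash a b)" for a b
    using bl by (simp_all add: bilinear_op_def Vector_Spaces.linear_iff)
  have gen: "gen_bracket dashv vdash (scale r a) b = ?ss (gen_bracket dashv vdash a b)"
    "gen_bracket dashv vdash a (scale r b) = ?ss (gen_bracket dashv vdash a b)" for a b
    by (simp_all add: gen_bracket_def ops map_poly_pCons_additive additive_scale additive_map_poly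
        scale_right_distrib)
  have add: "additive (\<lambda>f. B (?s f) g)" "additive (\<lambda>g. B f (?s g))"
    "additive (\<lambda>f. ?ss (B f g))" "additive (\<lambda>g. ?ss (B f g))" for f g
    by (simp_all add: additive_def additive.add[OF s] additive.add[OF ss]
        additive.add[OF free.additive_left] additive.add[OF free.additive_right])
  have sconst: "?s [:a:] = [:scale r a:]" for a
    by (simp add: map_poly_pCons_additive additive_scale)
  have left: "B [:scale r a:] g = ?ss (B [:a:] g)" for a g
    by (rule additive_poly_eqI[OF free.additive_right add(4)]) (simp_all add: simps gen)
  show "B (?s f) g = ?ss (B f g)"
    by (rule additive_poly_eqI[OF add(1,3)]) (simp_all add: simps sconst left)
  have right: "B [:a:] (?s g) = ?ss (B [:a:] g)" for a g
    by (rule additive_poly_eqI[OF add(2,4)]) (simp_all add: simps sconst gen)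
  show "B f (?s g) = ?ss (B f g)"
    by (rule additive_poly_eqI[OF free.additive_left add(3)]) (simp_all add: simps right)
qed

lemma leibniz_iff_jacobi:
  "leibniz_conformal_algebra (free_smult scale) B \<longleftrightarrow>
     (\<forall>f g h. free.jacobi_lhs f g h = free.jacobi_rhs f g h)"
proof -
  have d: "free_smult scale [:0, 1:] = pCons 0" by (rule ext) (rule smult_del)
  have r: "free_smult scale [:r:] = map_poly (scale r)" for r by (rule ext) (rule smult_const)
  show ?thesis
    by (simp add: leibniz_conformal_algebra_def leibniz_conformal_algebra_axioms_def d r
        module_free_smult free_bracket_scale free.del_left free.del_right
        additive.add[OF free.additive_left] additive.add[OF free.additive_right]
        free.jacobi_lhs_def free.jacobi_rhs_def free.nest_left_def free.nest_right_def)
qed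

text \<open>
  The inner bracket \<open>[b\<^bsub>T\<^esub>c]\<close> contributes \<open>\<partial>(c \<stileturn> b)\<close> and \<open>T(b \<turnstile> c + c \<stileturn> b)\<close>. Its \<open>\<partial>\<close> leaves the outer
  bracket as \<open>S + \<partial>\<close>, which accounts for all summands without \<open>T\<close>.
\<close>

lemma nest_right_generators:
  assumes S: "additive S" and T: "additive T"
  shows "free.nest_right S T [:a:] [:b:] [:c:] =
     [:[:[:0, 0, (c \<stileturn> b) \<stileturn> a:]:]:] +
     S ([:[:[:0, a \<turnstile> (c \<stileturn> b) + (c \<stileturn> b) \<stileturn> a + (c \<stileturn> b) \<stileturn> a:]:]:] +
        S [:[:[:a \<turnstile> (c \<stileturn> b) + (c \<stileturn> b) \<stileturn> a:]:]:]) +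
     T ([:[:[:0, (b \<turnstile> c + c \<stileturn> b) \<stileturn> a:]:]:] +
        S [:[:[:a \<turnstile> (b \<turnstile> c + c \<stileturn> b) + (b \<turnstile> c + c \<stileturn> b) \<stileturn> a:]:]:])"
  by (simp add: free.nest_right_def free_bracket_generators[OF vs bl] free.del_right gen_bracket_def
      eval_at_pCons_additive[OF T free.additive_inner(1)[OF S]] eval_at_0[OF T free.additive_inner(1)[OF S]]
      subst_var_pCons[OF S] subst_var_0[OF S] additive.zero[OF S] additive.zero[OF T]
      map_poly_pCons_additive[OF additive_pCons_0] additive.add[OF S] algebra_simps)

text \<open>
  Here the \<open>\<partial>\<close> in \<open>\<partial>(b \<stileturn> a)\<close> leaves the outer bracket on the left, as \<open>-S\<close>.
\<close>

lemma nest_left_generators: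
  assumes S: "additive S" and T: "additive T"
  shows "free.nest_left S T [:a:] [:b:] [:c:] =
     S ([:[:[:0, - (c \<stileturn> (b \<stileturn> a)):]:]:] +
        S [:[:[:- ((b \<stileturn> a) \<turnstile> c + c \<stileturn> (b \<stileturn> a)):]:]:]) +
     T ([:[:[:0, c \<stileturn> (a \<turnstile> b + b \<stileturn> a):]:]:] +
        S [:[:[:(a \<turnstile> b + b \<stileturn> a) \<turnstile> c + c \<stileturn> (a \<turnstile> b + b \<stileturn> a):]:]:])"
  by (simp add: free.nest_left_def free_bracket_generators[OF vs bl] free.del_left gen_bracket_def
      eval_at_pCons_additive[OF T free.additive_inner(2)[OF S]] eval_at_0[OF T free.additive_inner(2)[OF S]]
      subst_var_pCons[OF S] subst_var_0[OF S] additive.zero[OF S] additive.zero[OF T]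
      additive.add[OF S] algebra_simps)

text \<open>
  The outermost list runs over the powers of \<open>\<mu>\<close>, the middle one over those of \<open>\<lambda>\<close>, the innermost
  one over those of \<open>\<partial>\<close>. Only monomials of degree two occur, and \<open>\<mu>\<^sup>2\<close> is absent here because
  \<open>\<mu>\<close> enters \<open>[a\<^sub>\<lambda>[b\<^sub>\<mu>c]]\<close> only through the inner bracket, which is linear in it.
\<close>

lemma jacobi_lhs_generators:
  "free.jacobi_lhs [:a:] [:b:] [:c:] =
     [: [: [:0, 0, (c \<stileturn> b) \<stileturn> a:],
           [:0, a \<turnstile> (c \<stileturn> b) + (c \<stileturn> b) \<stileturn> a + (c \<stileturn> b) \<stileturn> a:],
           [:a \<turnstile> (c \<stileturn> b) + (c \<stileturn> b) \<stileturn> a:] :],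
        [: [:0, (b \<turnstile> c + c \<stileturn> b) \<stileturn> a:],
           [:a \<turnstile> (b \<turnstile> c + c \<stileturn> b) + (b \<turnstile> c + c \<stileturn> b) \<stileturn> a:] :] :]"
  unfolding free.jacobi_lhs_def nest_right_generators[OF additive_mult_lambda additive_mult_mu]
  by (simp add: mult_lambda_def mult_mu_def map_poly_pCons_additive additive_pCons_0)

lemma jacobi_rhs_generators:
  "free.jacobi_rhs [:a:] [:b:] [:c:] =
     [: [: [:0, 0, (c \<stileturn> a) \<stileturn> b:],
           [:0, c \<stileturn> (a \<turnstile> b) + (a \<turnstile> c + c \<stileturn> a) \<stileturn> b:],
           [:(a \<turnstile> b) \<turnstile> c + c \<stileturn> (a \<turnstile> b):] :],
        [: [:0, b \<turnstile> (c \<stileturn> a) + (c \<stileturn> a) \<stileturn> b + (c \<stileturn> a) \<stileturn> b - c \<stileturn> (b \<stileturn> a):],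
           [:(a \<turnstile> b) \<turnstile> c + c \<stileturn> (a \<turnstile> b) - (b \<stileturn> a) \<turnstile> c - c \<stileturn> (b \<stileturn> a)
             + b \<turnstile> (a \<turnstile> c + c \<stileturn> a) + (a \<turnstile> c + c \<stileturn> a) \<stileturn> b:] :],
        [: [:b \<turnstile> (c \<stileturn> a) + (c \<stileturn> a) \<stileturn> b - (b \<stileturn> a) \<turnstile> c - c \<stileturn> (b \<stileturn> a):] :] :]"
  unfolding free.jacobi_rhs_def nest_right_generators[OF additive_mult_mu additive_mult_lambda]
    nest_left_generators[OF additive_mult_lambda_mu additive_mult_lambda]
  by (simp add: mult_lambda_mu_def mult_lambda_def mult_mu_def map_poly_pCons_additive
      additive_pCons_0 add_ops algebra_simps)

end

text \<open>
  The coefficient of \<open>\<partial>\<^sup>2\<close> is right commutativity of \<open>\<stileturn>\<close>. Modulo it, the coefficient of \<open>\<partial>\<mu>\<close> is the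
  left-symmetry law for the associator \<open>(c, b, a)\<close> of \<open>\<stileturn>\<close>, and the coefficient of \<open>\<partial>\<lambda>\<close> is the same
  law with \<open>a\<close> and \<open>b\<close> exchanged, except that \<open>c \<stileturn> (a \<turnstile> b)\<close> replaces \<open>c \<stileturn> (a \<stileturn> b)\<close>; together they
  say that these two products agree. Given this law, the coefficients of \<open>\<lambda>\<^sup>2\<close> and \<open>\<mu>\<^sup>2\<close> express
  \<open>(x \<turnstile> y) \<turnstile> z\<close> and \<open>(x \<stileturn> y) \<turnstile> z\<close> as \<open>(x \<turnstile> z) \<stileturn> y\<close>, and subtracting everything known from the
  coefficient of \<open>\<lambda>\<mu>\<close> leaves the left-symmetry law for \<open>\<turnstile>\<close>. Each step can be reversed.
\<close>

lemma jacobi_coefficients_iff_novikov: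
  fixes dashv :: "'a::ab_group_add \<Rightarrow> 'a \<Rightarrow> 'a" (infixl "\<stileturn>" 70)
    and vdash :: "'a \<Rightarrow> 'a \<Rightarrow> 'a" (infixl "\<turnstile>" 70)
  assumes "\<And>a b c. (a + b) \<stileturn> c = a \<stileturn> c + b \<stileturn> c" "\<And>a b c. c \<stileturn> (a + b) = c \<stileturn> a + c \<stileturn> b"
    and "\<And>a b c. (a + b) \<turnstile> c = a \<turnstile> c + b \<turnstile> c" "\<And>a b c. c \<turnstile> (a + b) = c \<turnstile> a + c \<turnstile> b"
  shows
  "(\<forall>a b c. (c \<stileturn> b) \<stileturn> a = (c \<stileturn> a) \<stileturn> b \<and>
     a \<turnstile> (c \<stileturn> b) + (c \<stileturn> b) \<stileturn> a + (c \<stileturn> b) \<stileturn> a = c \<stileturn> (a \<turnstile> b) + (a \<turnstile> c + c \<stileturn> a) \<stileturn> b \<and>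
     a \<turnstile> (c \<stileturn> b) + (c \<stileturn> b) \<stileturn> a = (a \<turnstile> b) \<turnstile> c + c \<stileturn> (a \<turnstile> b) \<and>
     (b \<turnstile> c + c \<stileturn> b) \<stileturn> a = b \<turnstile> (c \<stileturn> a) + (c \<stileturn> a) \<stileturn> b + (c \<stileturn> a) \<stileturn> b - c \<stileturn> (b \<stileturn> a) \<and>
     a \<turnstile> (b \<turnstile> c + c \<stileturn> b) + (b \<turnstile> c + c \<stileturn> b) \<stileturn> a =
       (a \<turnstile> b) \<turnstile> c + c \<stileturn> (a \<turnstile> b) - (b \<stileturn> a) \<turnstile> c - c \<stileturn> (b \<stileturn> a)
         + b \<turnstile> (a \<turnstile> c + c \<stileturn> a) + (a \<turnstile> c + c \<stileturn> a) \<stileturn> b \<and>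
     b \<turnstile> (c \<stileturn> a) + (c \<stileturn> a) \<stileturn> b - (b \<stileturn> a) \<turnstile> c - c \<stileturn> (b \<stileturn> a) = 0)
   \<longleftrightarrow>
   (\<forall>a b c. (a \<turnstile> b) \<stileturn> c = (a \<turnstile> c) \<turnstile> b \<and> (a \<turnstile> c) \<turnstile> b = (a \<stileturn> c) \<turnstile> b \<and> a \<stileturn> (b \<stileturn> c) = a \<stileturn> (b \<turnstile> c) \<and>
     (a \<stileturn> b) \<stileturn> c = (a \<stileturn> c) \<stileturn> b \<and>
     (a \<stileturn> b) \<stileturn> c - a \<stileturn> (b \<stileturn> c) = (b \<turnstile> a) \<stileturn> c - b \<turnstile> (a \<stileturn> c) \<and>
     (a \<turnstile> b) \<turnstile> c - a \<turnstile> (b \<turnstile> c) = (b \<turnstile> a) \<turnstile> c - b \<turnstile> (a \<turnstile> c))" (is "?J \<longleftrightarrow> ?N")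
proof
  assume J: ?J
  have del_sq: "(c \<stileturn> b) \<stileturn> a = (c \<stileturn> a) \<stileturn> b"
    and del_lambda: "a \<turnstile> (c \<stileturn> b) + (c \<stileturn> b) \<stileturn> a + (c \<stileturn> b) \<stileturn> a = c \<stileturn> (a \<turnstile> b) + (a \<turnstile> c + c \<stileturn> a) \<stileturn> b"
    and lambda_sq: "a \<turnstile> (c \<stileturn> b) + (c \<stileturn> b) \<stileturn> a = (a \<turnstile> b) \<turnstile> c + c \<stileturn> (a \<turnstile> b)"
    and del_mu: "(b \<turnstile> c + c \<stileturn> b) \<stileturn> a = b \<turnstile> (c \<stileturn> a) + (c \<stileturn> a) \<stileturn> b + (c \<stileturn> a) \<stileturn> b - c \<stileturn> (b \<stileturn> a)"
    and lambda_mu: "a \<turnstile> (b \<turnstile> c + c \<stileturn> b) + (b \<turnstile> c + c \<stileturn> b) \<stileturn> a =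
       (a \<turnstile> b) \<turnstile> c + c \<stileturn> (a \<turnstile> b) - (b \<stileturn> a) \<turnstile> c - c \<stileturn> (b \<stileturn> a)
         + b \<turnstile> (a \<turnstile> c + c \<stileturn> a) + (a \<turnstile> c + c \<stileturn> a) \<stileturn> b"
    and mu_sq: "b \<turnstile> (c \<stileturn> a) + (c \<stileturn> a) \<stileturn> b - (b \<stileturn> a) \<turnstile> c - c \<stileturn> (b \<stileturn> a) = 0" for a b c
    using J by blast+
  have dassoc: "(b \<turnstile> c) \<stileturn> a = b \<turnstile> (c \<stileturn> a) + (c \<stileturn> a) \<stileturn> b - c \<stileturn> (b \<stileturn> a)" for a b c
    using del_mu[of b c a] del_sq[of c b a] by (simp add: assms algebra_simps)
  have right: "c \<stileturn> (a \<turnstile> b) = c \<stileturn> (a \<stileturn> b)" for a b c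
    using del_lambda[of a c b] del_sq[of c b a] dassoc[of a c b] by (simp add: assms algebra_simps)
  have vd: "(a \<turnstile> c) \<stileturn> b = (a \<turnstile> b) \<turnstile> c" for a b c
    using lambda_sq[of a c b] dassoc[of a c b] right[of c a b] by (simp add: algebra_simps)
  have vv: "(b \<stileturn> a) \<turnstile> c = (b \<turnstile> c) \<stileturn> a" for a b c
    using mu_sq[of b c a] dassoc[of b c a] by (simp add: algebra_simps)
  have vassoc: "a \<turnstile> (b \<turnstile> c) + (b \<turnstile> a) \<turnstile> c = (a \<turnstile> b) \<turnstile> c + b \<turnstile> (a \<turnstile> c)" for a b c
  proof -
    \<comment> \<open>Used as a rewrite rule, this removes all products \<open>x \<stileturn> (y \<stileturn> z)\<close> from the coefficient of \<open>\<lambda>\<mu>\<close>.\<close>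
    have e: "c \<stileturn> (b \<stileturn> a) = b \<turnstile> (c \<stileturn> a) + (c \<stileturn> a) \<stileturn> b - (b \<turnstile> a) \<turnstile> c" for a b
      using mu_sq[of b c a] vv[of b a c] vd[of b c a] by (simp add: algebra_simps)
    show ?thesis
      using lambda_mu[of a b c]
      by (simp add: assms right e vv vd del_sq[of c b a] algebra_simps)
  qed
  show ?N
  proof (intro allI conjI)
    fix a b c
    show "(a \<turnstile> b) \<stileturn> c = (a \<turnstile> c) \<turnstile> b" by (rule vd)
    show "(a \<turnstile> c) \<turnstile> b = (a \<stileturn> c) \<turnstile> b" by (simp add: vd vv)
    show "a \<stileturn> (b \<stileturn> c) = a \<stileturn> (b \<turnstile> c)" by (rule right[symmetric])
    show "(a \<stileturn> b) \<stileturn> c = (a \<stileturn> c) \<stileturn> b" by (rule del_sq)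
    show "(a \<stileturn> b) \<stileturn> c - a \<stileturn> (b \<stileturn> c) = (b \<turnstile> a) \<stileturn> c - b \<turnstile> (a \<stileturn> c)"
      using dassoc[of b a c] del_sq[of a b c] by (simp add: algebra_simps)
    show "(a \<turnstile> b) \<turnstile> c - a \<turnstile> (b \<turnstile> c) = (b \<turnstile> a) \<turnstile> c - b \<turnstile> (a \<turnstile> c)"
      using vassoc[of a b c] by (simp add: algebra_simps)
  qed
next
  assume N: ?N
  note n = N[THEN spec, THEN spec, THEN spec]
  have comm: "(a \<stileturn> b) \<stileturn> c = (a \<stileturn> c) \<stileturn> b" and right: "a \<stileturn> (b \<turnstile> c) = a \<stileturn> (b \<stileturn> c)"
    and vd: "(a \<turnstile> b) \<stileturn> c = (a \<turnstile> c) \<turnstile> b" and vv: "(a \<turnstile> c) \<turnstile> b = (a \<stileturn> c) \<turnstile> b"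
    and dassoc: "(a \<stileturn> b) \<stileturn> c - a \<stileturn> (b \<stileturn> c) = (b \<turnstile> a) \<stileturn> c - b \<turnstile> (a \<stileturn> c)"
    and vassoc: "(a \<turnstile> b) \<turnstile> c - a \<turnstile> (b \<turnstile> c) = (b \<turnstile> a) \<turnstile> c - b \<turnstile> (a \<turnstile> c)" for a b c
    using n[of a b c] n[of a c b] by metis+
  show ?J
  proof (intro allI conjI)
    fix a b c
    \<comment> \<open>The dialgebra laws used as rewrite rules eliminate the products \<open>x \<stileturn> (y \<stileturn> z)\<close>, \<open>x \<stileturn> (y \<turnstile> z)\<close>,
      \<open>(x \<turnstile> y) \<stileturn> z\<close> and \<open>(x \<turnstile> y) \<turnstile> z\<close>; what then remains is linear.\<close>
    have e: "c \<stileturn> (b \<stileturn> a) = b \<turnstile> (c \<stileturn> a) + (c \<stileturn> a) \<stileturn> b - (b \<turnstile> c) \<stileturn> a" for a b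
      using dassoc[of c b a] comm[of c b a] by (simp add: algebra_simps)
    show "(c \<stileturn> b) \<stileturn> a = (c \<stileturn> a) \<stileturn> b"
      by (rule comm)
    show "a \<turnstile> (c \<stileturn> b) + (c \<stileturn> b) \<stileturn> a + (c \<stileturn> b) \<stileturn> a = c \<stileturn> (a \<turnstile> b) + (a \<turnstile> c + c \<stileturn> a) \<stileturn> b"
      using comm[of c b a] vassoc[of a b c] by (simp add: assms right e vd vv algebra_simps)
    show "a \<turnstile> (c \<stileturn> b) + (c \<stileturn> b) \<stileturn> a = (a \<turnstile> b) \<turnstile> c + c \<stileturn> (a \<turnstile> b)"
      using comm[of c b a] vassoc[of a b c] by (simp add: assms right e vd vv algebra_simps)
    show "(b \<turnstile> c + c \<stileturn> b) \<stileturn> a = b \<turnstile> (c \<stileturn> a) + (c \<stileturn> a) \<stileturn> b + (c \<stileturn> a) \<stileturn> b - c \<stileturn> (b \<stileturn> a)"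
      using comm[of c b a] vassoc[of a b c] by (simp add: assms right e vd vv algebra_simps)
    show "a \<turnstile> (b \<turnstile> c + c \<stileturn> b) + (b \<turnstile> c + c \<stileturn> b) \<stileturn> a =
       (a \<turnstile> b) \<turnstile> c + c \<stileturn> (a \<turnstile> b) - (b \<stileturn> a) \<turnstile> c - c \<stileturn> (b \<stileturn> a)
         + b \<turnstile> (a \<turnstile> c + c \<stileturn> a) + (a \<turnstile> c + c \<stileturn> a) \<stileturn> b"
      using comm[of c b a] vassoc[of a b c] by (simp add: assms right e vd vv algebra_simps)
    show "b \<turnstile> (c \<stileturn> a) + (c \<stileturn> a) \<stileturn> b - (b \<stileturn> a) \<turnstile> c - c \<stileturn> (b \<stileturn> a) = 0"
      using comm[of c b a] vassoc[of a b c] by (simp add: assms right e vd vv algebra_simps)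
  qed
qed

theorem proposition2p8:
  fixes scale :: "'k::field_char_0 \<Rightarrow> 'a::ab_group_add \<Rightarrow> 'a"
    and dashv vdash :: "'a \<Rightarrow> 'a \<Rightarrow> 'a"
  assumes "vector_space scale"
    and "bilinear_op scale dashv"
    and "bilinear_op scale vdash"
  shows "leibniz_conformal_algebra (free_smult scale) (free_bracket dashv vdash)
         \<longleftrightarrow> novikov_dialgebra scale dashv vdash"
proof -
  interpret free: sesquilinear_bracket "pCons 0" "free_bracket dashv vdash"
    by (rule sesquilinear_free_bracket[OF assms])
  have "leibniz_conformal_algebra (free_smult scale) (free_bracket dashv vdash) \<longleftrightarrow>
      (\<forall>a b c. free.jacobi_lhs [:a:] [:b:] [:c:] = free.jacobi_rhs [:a:] [:b:] [:c:])"
    unfolding leibniz_iff_jacobi[OF assms]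
    using jacobi_from_generators[OF free.sesquilinear_bracket_axioms] by blast
  also have "\<dots> \<longleftrightarrow> novikov_dialgebra scale dashv vdash"
    unfolding jacobi_lhs_generators[OF assms] jacobi_rhs_generators[OF assms] novikov_dialgebra_def
      novikov_dialgebra_axioms_def
    using jacobi_coefficients_iff_novikov[OF ops_add[OF assms]] assms
    by (simp; blast)
  finally show ?thesis .
qed

end
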